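(* Let $\mathcal H$ be the Hecke algebra of $G_4$. The set $\{b_1,\dots,b_7\}$ is an $R$-basis of the centre of $\mathcal H$, where $$b_1=\tilde T_1,\qquad b_2=\tilde T_{ststst},$$ $$b_3=\tilde T_s+\tilde T_t+\tilde T_{s^2ts}+\tilde T_{sts^2}-\xi_2\tilde T_{sts},$$ $$b_4=\tilde T_{ts}+\tilde T_{st}+\tilde T_{s^2ts^2}+\tilde T_{t^2st^2}+\xi_1\tilde T_{sts},$$ $$b_5=\tilde T_{s^2}+\tilde T_{t^2}+\tilde T_{st^2s^2}+\tilde T_{s^2t^2s}+\xi_1^2(\tilde T_{sts^2}+\tilde T_{s^2ts})+\xi_1(\tilde T_{s^2t}+\tilde T_{ts^2})+\xi_1\tilde T_{sts}+\xi_2(\tilde T_{ts^2t}-\tilde T_{st^2s})+\xi_1\xi_2(\tilde T_{t^2st^2}+\tilde T_{s^2ts^2}),$$ $$b_6=\tilde T_{ts^2}+\tilde T_{s^2t}+\tilde T_{sts}+\tilde T_{st^2}+\tilde T_{t^2s}+\tilde T_{s^2t^2s^2}+\xi_2\tilde T_{t^2st^2}+\xi_2^2\tilde T_{ts^2t}+\xi_1\tilde T_t+(2\xi_1+\xi_1^2\xi_2)(\tilde T_{s^2ts}+\tilde T_{sts^2})+\xi_1\xi_2(\tilde T_{ts^2}+\tilde T_{s^2t})+\xi_1(\tilde T_{st^2s}+\tilde T_{ts^2t})+\xi_2(1+\xi_1\xi_2)(\tilde T_{s^2ts^2}+\tilde T_{t^2st^2}),$$ $$b_7=\tilde T_{ts^2t}+\tilde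 T_{s^2t^2}+\tilde T_{t^2s^2}+\tilde T_{st^2s}+\xi_2\tilde T_{s^2t^2s^2}+\xi_1(\xi_1+\xi_2^2)(\tilde T_{ts^2}+\tilde T_{s^2t})+\xi_1(\xi_1^2+\xi_2+\xi_1\xi_2^2)(\tilde T_{sts^2}+\tilde T_{s^2ts})+\xi_1(\tilde T_{st^2s^2}+\tilde T_{s^2t^2s})+\xi_1\xi_2\tilde T_t+\xi_1^2\tilde T_{sts}+\xi_2(2\xi_1+\xi_2^2)\tilde T_{ts^2t}+\xi_2(\xi_2+\xi_1^2+\xi_1\xi_2^2)\tilde T_{t^2st^2}+\xi_1\xi_2(\xi_1+\xi_2^2)\tilde T_{s^2ts^2}.$$
   Context: $G_4=\langle s,t\mid s^3=t^3=1,\ sts=tst\rangle$ (a group of order 24). Let $\xi_1,\xi_2$ be indeterminates and $R=\mathbb Z[\xi_1,\xi_2]$. The Hecke algebra $\mathcal H$ of $G_4$ is the $R$-algebra generated by $\tilde T_s,\tilde T_t$ subject to $\tilde T_s\tilde T_t\tilde T_s=\tilde T_t\tilde T_s\tilde T_t$ and $\tilde T_x^3=1+\xi_1\tilde T_x+\xi_2\tilde T_x^2$ for $x\in\{s,t\}$. For a word $x_1\cdots x_k$ in $s,t$ put $\tilde T_{x_1\cdots x_k}=\tilde T_{x_1}\cdots\tilde T_{x_k}$, $\tilde T_1=1$. $\mathcal H$ is a free $R$-module of rank 24, with $R$-basis $B_{sts}$ consisting of the elements $\tilde T_w$ for the words $w\in\{1,s,t,s^2,t^2,st,ts,st^2,t^2s,s^2t,ts^2,s^2t^2,t^2s^2,st^2s,ts^2t,s^2ts^2,t^2st^2,ststst,sts,sts^2,s^2ts,s^2t^2s,st^2s^2,s^2t^2s^2\}$.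 *)

theory Defs
  imports "HOL-Library.Poly_Mapping" "HOL-Computational_Algebra.Polynomial"
begin

text \<open>
  The base ring \<open>R = \<int>[\<xi>\<^sub>1, \<xi>\<^sub>2]\<close> is \<^typ>\<open>int poly poly\<close>: \<open>\<xi>\<^sub>1\<close> is the inner and
  \<open>\<xi>\<^sub>2\<close> the outer indeterminate.
\<close>

type_synonym R = "int poly poly"

definition xi1 :: R  (\<open>\<xi>\<^sub>1\<close>) where "\<xi>\<^sub>1 = [:[:0, 1:]:]"
definition xi2 :: R  (\<open>\<xi>\<^sub>2\<close>) where "\<xi>\<^sub>2 = [:0, 1:]"

text \<open>
  The free associative \<open>R\<close>-algebra on \<open>s, t\<close> is the monoid algebra of the free monoid of words.
  The multiplication of \<^typ>\<open>'a \<Rightarrow>\<^sub>0 'b\<close> is convolution over an additively written (possibly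
  noncommutative) monoid, so concatenation of words is written \<open>+\<close> and the empty word \<open>0\<close>.
\<close>

datatype gen = S | T

datatype gword = Word "gen list"

instantiation gword :: monoid_add
begin

definition zero_gword :: gword where "0 = Word []"

fun plus_gword :: "gword \<Rightarrow> gword \<Rightarrow> gword" where
  "Word u + Word v = Word (u @ v)"

instance
proof
  fix a b c :: gword
  show "a + b + c = a + (b + c)"
    by (cases a; cases b; cases c) simp
  show "0 + a = a"
    by (cases a) (simp add: zero_gword_def)
  show "a + 0 = a"
    by (cases a) (simp add: zero_gword_def)
qed

end

type_synonym free_alg = "gword \<Rightarrow>\<^sub>0 R"

definition free_gen :: "gen \<Rightarrow> free_alg" where
  "free_gen x = Poly_Mapping.single (Word [x]) 1"

definition free_const :: "R \<Rightarrow> free_alg" where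
  "free_const c = Poly_Mapping.single 0 c"

lemma free_const_0: "free_const 0 = 0"
  by (simp add: free_const_def)

lemma free_const_1: "free_const 1 = 1"
  by (simp add: free_const_def)

lemma free_const_add: "free_const (c + d) = free_const c + free_const d"
  by (simp add: free_const_def single_add)

lemma free_const_mult: "free_const (c * d) = free_const c * free_const d"
  by (simp add: free_const_def mult_single)

lemma free_const_commute: "free_const c * f = f * free_const c"
proof (induction f rule: update_induct)
  case const
  show ?case by simp
next
  case (update f a b)
  have "Poly_Mapping.update a b f = f + Poly_Mapping.single a b"
  proof (rule poly_mapping_eqI)
    fix k
    have "Poly_Mapping.lookup f a = 0"
      using update(1) by (simp add: in_keys_iff)
    then show "Poly_Mapping.lookup (Poly_Mapping.update a b f) k
        = Poly_Mapping.lookup (f + Poly_Mapping.single a b) k"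
      by (cases "k = a") (simp_all add: lookup_update lookup_add lookup_single)
  qed
  moreover have "free_const c * Poly_Mapping.single a b = Poly_Mapping.single a b * free_const c"
    by (simp add: free_const_def mult_single mult.commute)
  ultimately show ?case
    using update.IH by (simp add: distrib_left distrib_right)
qed

inductive_set hecke_relators :: "free_alg set" where
  braid: "free_gen S * free_gen T * free_gen S - free_gen T * free_gen S * free_gen T
            \<in> hecke_relators"
| cubic: "free_gen x ^ 3
            - (1 + free_const \<xi>\<^sub>1 * free_gen x + free_const \<xi>\<^sub>2 * free_gen x ^ 2)
            \<in> hecke_relators"

text \<open>
  The two-sided ideal generated by the relators. Closure under negation and under scalars is the
  case of \<open>mult_left\<close> with a constant left factor.
\<close>

inductive_set hecke_ideal :: "free_alg set" where
  base: "r \<in> hecke_relators \<Longrightarrow> r \<in> hecke_ideal"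
| zero: "0 \<in> hecke_ideal"
| add: "f \<in> hecke_ideal \<Longrightarrow> g \<in> hecke_ideal \<Longrightarrow> f + g \<in> hecke_ideal"
| mult_left: "f \<in> hecke_ideal \<Longrightarrow> a * f \<in> hecke_ideal"
| mult_right: "f \<in> hecke_ideal \<Longrightarrow> f * a \<in> hecke_ideal"

definition hecke_eq :: "free_alg \<Rightarrow> free_alg \<Rightarrow> bool" where
  "hecke_eq f g \<longleftrightarrow> f - g \<in> hecke_ideal"

lemma hecke_ideal_uminus: "f \<in> hecke_ideal \<Longrightarrow> - f \<in> hecke_ideal"
  using hecke_ideal.mult_left[of f "- 1"] by simp

lemma equivp_hecke_eq: "equivp hecke_eq"
proof (rule equivpI)
  show "reflp hecke_eq"
    by (rule reflpI) (simp add: hecke_eq_def hecke_ideal.zero)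
  show "symp hecke_eq"
    by (rule sympI) (metis hecke_eq_def hecke_ideal_uminus minus_diff_eq)
  show "transp hecke_eq"
  proof (rule transpI)
    fix f g h assume "hecke_eq f g" "hecke_eq g h"
    then show "hecke_eq f h"
      using hecke_ideal.add[of "f - g" "g - h"] by (simp add: hecke_eq_def)
  qed
qed

lemma hecke_eq_refl: "hecke_eq f f"
  by (simp add: hecke_eq_def hecke_ideal.zero)

lemma hecke_eq_add:
  assumes "hecke_eq f f'" "hecke_eq g g'" shows "hecke_eq (f + g) (f' + g')"
  using assms hecke_ideal.add[of "f - f'" "g - g'"] by (simp add: hecke_eq_def algebra_simps)

lemma hecke_eq_uminus:
  assumes "hecke_eq f f'" shows "hecke_eq (- f) (- f')"
  using assms hecke_ideal_uminus[of "f - f'"] by (simp add: hecke_eq_def algebra_simps)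

lemma hecke_eq_mult:
  assumes "hecke_eq f f'" "hecke_eq g g'" shows "hecke_eq (f * g) (f' * g')"
proof -
  have "f * g - f' * g' = (f - f') * g + f' * (g - g')"
    by (simp add: algebra_simps)
  also have "\<dots> \<in> hecke_ideal"
    using assms unfolding hecke_eq_def
    by (intro hecke_ideal.add hecke_ideal.mult_left hecke_ideal.mult_right)
  finally show ?thesis by (simp add: hecke_eq_def)
qed

quotient_type hecke = free_alg / hecke_eq
  by (rule equivp_hecke_eq)

text \<open>
  The class \<open>ring_1\<close> would require \<open>0 \<noteq> 1\<close>, which is not immediate for an algebra given by a
  presentation; a unital ring without that requirement is \<open>ring\<close> plus \<open>monoid_mult\<close>.
\<close>

instantiation hecke :: "{ring, monoid_mult}"
begin

lift_definition zero_hecke :: hecke is 0 .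
lift_definition one_hecke :: hecke is 1 .
lift_definition plus_hecke :: "hecke \<Rightarrow> hecke \<Rightarrow> hecke" is "(+)"
  by (rule hecke_eq_add)
lift_definition uminus_hecke :: "hecke \<Rightarrow> hecke" is uminus
  by (rule hecke_eq_uminus)
lift_definition minus_hecke :: "hecke \<Rightarrow> hecke \<Rightarrow> hecke" is "(-)"
proof -
  fix f f' g g' :: free_alg
  assume "hecke_eq f f'" "hecke_eq g g'"
  then have "hecke_eq (f + - g) (f' + - g')"
    by (intro hecke_eq_add hecke_eq_uminus)
  then show "hecke_eq (f - g) (f' - g')" by simp
qed
lift_definition times_hecke :: "hecke \<Rightarrow> hecke \<Rightarrow> hecke" is "(*)"
  by (rule hecke_eq_mult)

instance
proof
  fix a b c :: hecke
  show "a + b + c = a + (b + c)" "a + b = b + a" "0 + a = a" "- a + a = 0" "a - b = a + - b"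
    and "a * b * c = a * (b * c)" "(a + b) * c = a * c + b * c" "a * (b + c) = a * b + a * c"
    and "1 * a = a" "a * 1 = a"
    by (transfer; simp add: algebra_simps hecke_eq_refl)+
qed

end

lift_definition hscale :: "R \<Rightarrow> hecke \<Rightarrow> hecke"  (infixr \<open>*\<^sub>H\<close> 75)
  is "\<lambda>c f. free_const c * f"
  by (intro hecke_eq_mult hecke_eq_refl)

global_interpretation hecke: module hscale
proof
  fix a b :: R and x y :: hecke
  show "a *\<^sub>H (x + y) = a *\<^sub>H x + a *\<^sub>H y"
    and "(a + b) *\<^sub>H x = a *\<^sub>H x + b *\<^sub>H x"
    and "a *\<^sub>H b *\<^sub>H x = (a * b) *\<^sub>H x"
    and "1 *\<^sub>H x = x"
    by (transfer; simp add: distrib_left distrib_right mult.assoc free_const_1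
        free_const_add free_const_mult hecke_eq_refl)+
qed

lemma hscale_mult_left: "(c *\<^sub>H x) * y = c *\<^sub>H (x * y)"
  by transfer (simp add: mult.assoc hecke_eq_refl)

lemma hscale_mult_right: "x * (c *\<^sub>H y) = c *\<^sub>H (x * y)"
proof transfer
  fix f g :: free_alg and c :: R
  have "f * (free_const c * g) = (f * free_const c) * g"
    by (simp only: mult.assoc)
  also have "\<dots> = (free_const c * f) * g"
    by (simp only: free_const_commute)
  also have "\<dots> = free_const c * (f * g)"
    by (simp only: mult.assoc)
  finally show "hecke_eq (f * (free_const c * g)) (free_const c * (f * g))"
    by (simp add: hecke_eq_refl)
qed

lift_definition hecke_gen :: "gen \<Rightarrow> hecke" is free_gen .

definition Tw :: "gen list \<Rightarrow> hecke" where
  "Tw w = prod_list (map hecke_gen w)"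

lemma hecke_braid:
  "hecke_gen S * hecke_gen T * hecke_gen S = hecke_gen T * hecke_gen S * hecke_gen T"
  by transfer (simp add: hecke_eq_def hecke_ideal.base hecke_relators.braid)

lemma hecke_cubic:
  "hecke_gen x ^ 3 = 1 + \<xi>\<^sub>1 *\<^sub>H hecke_gen x + \<xi>\<^sub>2 *\<^sub>H hecke_gen x ^ 2"
proof -
  have "hecke_gen x * (hecke_gen x * hecke_gen x)
      = 1 + \<xi>\<^sub>1 *\<^sub>H hecke_gen x + \<xi>\<^sub>2 *\<^sub>H (hecke_gen x * hecke_gen x)"
    using hecke_ideal.base[OF hecke_relators.cubic[of x]]
    by transfer (simp add: hecke_eq_def power3_eq_cube power2_eq_square mult.assoc)
  then show ?thesis
    by (simp add: power3_eq_cube power2_eq_square mult.assoc)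
qed

definition centre :: "'a::semigroup_mult set" where
  "centre = {z. \<forall>x. z * x = x * z}"

definition b1 :: hecke where
  "b1 = Tw []"

definition b2 :: hecke where
  "b2 = Tw [S,T,S,T,S,T]"

definition b3 :: hecke where
  "b3 = Tw [S] + Tw [T] + Tw [S,S,T,S] + Tw [S,T,S,S] - \<xi>\<^sub>2 *\<^sub>H Tw [S,T,S]"

definition b4 :: hecke where
  "b4 = Tw [T,S] + Tw [S,T] + Tw [S,S,T,S,S] + Tw [T,T,S,T,T] + \<xi>\<^sub>1 *\<^sub>H Tw [S,T,S]"

definition b5 :: hecke where
  "b5 = Tw [S,S] + Tw [T,T] + Tw [S,T,T,S,S] + Tw [S,S,T,T,S]
      + \<xi>\<^sub>1^2 *\<^sub>H (Tw [S,T,S,S] + Tw [S,S,T,S])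
      + \<xi>\<^sub>1 *\<^sub>H (Tw [S,S,T] + Tw [T,S,S])
      + \<xi>\<^sub>1 *\<^sub>H Tw [S,T,S]
      + \<xi>\<^sub>2 *\<^sub>H (Tw [T,S,S,T] - Tw [S,T,T,S])
      + (\<xi>\<^sub>1 * \<xi>\<^sub>2) *\<^sub>H (Tw [T,T,S,T,T] + Tw [S,S,T,S,S])"

definition b6 :: hecke where
  "b6 = Tw [T,S,S] + Tw [S,S,T] + Tw [S,T,S] + Tw [S,T,T] + Tw [T,T,S] + Tw [S,S,T,T,S,S]
      + \<xi>\<^sub>2 *\<^sub>H Tw [T,T,S,T,T]
      + \<xi>\<^sub>2^2 *\<^sub>H Tw [T,S,S,T]
      + \<xi>\<^sub>1 *\<^sub>H Tw [T]
      + (2 * \<xi>\<^sub>1 + \<xi>\<^sub>1^2 * \<xi>\<^sub>2) *\<^sub>H (Tw [S,S,T,S] + Tw [S,T,S,S])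
      + (\<xi>\<^sub>1 * \<xi>\<^sub>2) *\<^sub>H (Tw [T,S,S] + Tw [S,S,T])
      + \<xi>\<^sub>1 *\<^sub>H (Tw [S,T,T,S] + Tw [T,S,S,T])
      + (\<xi>\<^sub>2 * (1 + \<xi>\<^sub>1 * \<xi>\<^sub>2)) *\<^sub>H (Tw [S,S,T,S,S] + Tw [T,T,S,T,T])"

definition b7 :: hecke where
  "b7 = Tw [T,S,S,T] + Tw [S,S,T,T] + Tw [T,T,S,S] + Tw [S,T,T,S]
      + \<xi>\<^sub>2 *\<^sub>H Tw [S,S,T,T,S,S]
      + (\<xi>\<^sub>1 * (\<xi>\<^sub>1 + \<xi>\<^sub>2^2)) *\<^sub>H (Tw [T,S,S] + Tw [S,S,T])
      + (\<xi>\<^sub>1 * (\<xi>\<^sub>1^2 + \<xi>\<^sub>2 + \<xi>\<^sub>1 * \<xi>\<^sub>2^2)) *\<^sub>H (Tw [S,T,S,S] + Tw [S,S,T,S])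
      + \<xi>\<^sub>1 *\<^sub>H (Tw [S,T,T,S,S] + Tw [S,S,T,T,S])
      + (\<xi>\<^sub>1 * \<xi>\<^sub>2) *\<^sub>H Tw [T]
      + \<xi>\<^sub>1^2 *\<^sub>H Tw [S,T,S]
      + (\<xi>\<^sub>2 * (2 * \<xi>\<^sub>1 + \<xi>\<^sub>2^2)) *\<^sub>H Tw [T,S,S,T]
      + (\<xi>\<^sub>2 * (\<xi>\<^sub>2 + \<xi>\<^sub>1^2 + \<xi>\<^sub>1 * \<xi>\<^sub>2^2)) *\<^sub>H Tw [T,T,S,T,T]
      + (\<xi>\<^sub>1 * \<xi>\<^sub>2 * (\<xi>\<^sub>1 + \<xi>\<^sub>2^2)) *\<^sub>H Tw [S,S,T,S,S]"

end

(*
The operators of left multiplication by the generators on the basis B_sts can be written down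
explicitly; they satisfy the braid and cubic relations, so they give a representation of the
Hecke algebra on R^24, and acting on the first basis vector yields coordinates. That the 24 words
span follows from the rewriting rules tst -> sts, tssts -> stsst, tsstt -> ..., ttsst -> ..., all
consequences of the relations. Hence the Hecke algebra is R^24 with known left and right
multiplications, and an element is central iff its coordinates solve a homogeneous linear system.
The coefficients of a central element at 1, ststst, s, st, s^2, st^2, s^2t^2 determine it (the system
is solved by eliminations with unit coefficients), and on b_1, ..., b_7 they form the identity
matrix.
*)
theory Submission
  imports Defs
begin

section \<open>The 24 basis words and the matrices of left and right multiplication by
  generators\<close>

datatype bword =
    B1 | Bs | Bt | Bss | Bst | Bts | Btt | Bsst | Bsts | Bstt | Btss | Btts | Bssts | Bsstt | Bstss
    | Bstts | Btsst | Bttss | Bsstss | Bsstts | Bttstt | Bsttss | Bststst | Bssttss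

primrec word :: "bword \<Rightarrow> gen list" where
  "word B1 = []"
| "word Bs = [S]"
| "word Bt = [T]"
| "word Bss = [S, S]"
| "word Bst = [S, T]"
| "word Bts = [T, S]"
| "word Btt = [T, T]"
| "word Bsst = [S, S, T]"
| "word Bsts = [S, T, S]"
| "word Bstt = [S, T, T]"
| "word Btss = [T, S, S]"
| "word Btts = [T, T, S]"
| "word Bssts = [S, S, T, S]"
| "word Bsstt = [S, S, T, T]"
| "word Bstss = [S, T, S, S]"
| "word Bstts = [S, T, T, S]"
| "word Btsst = [T, S, S, T]"
| "word Bttss = [T, T, S, S]"
| "word Bsstss = [S, S, T, S, S]"
| "word Bsstts = [S, S, T, T, S]"
| "word Bttstt = [T, T, S, T, T]"
| "word Bsttss = [S, T, T, S, S]"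
| "word Bststst = [S, T, S, T, S, T]"
| "word Bssttss = [S, S, T, T, S, S]"

lemma UNIV_bword:
  "UNIV = {B1, Bs, Bt, Bss, Bst, Bts, Btt, Bsst, Bsts, Bstt, Btss, Btts,
    Bssts, Bsstt, Bstss, Bstts, Btsst, Bttss, Bsstss, Bsstts, Bttstt, Bsttss, Bststst, Bssttss}"
  by (auto intro: bword.exhaust)

instance bword :: finite
  by standard (simp add: UNIV_bword)

type_synonym vec = "bword \<Rightarrow> R"

text \<open>
  The value at \<open>u\<close> is the coefficient of \<open>u\<close> in the product, so each equation is a row of the
  matrix of left multiplication.
\<close>

fun lmul :: "gen \<Rightarrow> vec \<Rightarrow> vec" where
  "lmul S v B1 = v Bss"
| "lmul S v Bs = v B1 + \<xi>\<^sub>1 * v Bss"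
| "lmul S v Bt = v Bsst"
| "lmul S v Bss = v Bs + \<xi>\<^sub>2 * v Bss"
| "lmul S v Bst = v Bt + \<xi>\<^sub>1 * v Bsst"
| "lmul S v Bts = v Bssts"
| "lmul S v Btt = v Bsstt"
| "lmul S v Bsst = v Bst + \<xi>\<^sub>2 * v Bsst"
| "lmul S v Bsts = v Bts + \<xi>\<^sub>1 * v Bssts"
| "lmul S v Bstt = v Btt + \<xi>\<^sub>1 * v Bsstt"
| "lmul S v Btss = v Bsstss"
| "lmul S v Btts = v Bsstts"
| "lmul S v Bssts = v Bsts + \<xi>\<^sub>2 * v Bssts"
| "lmul S v Bsstt = v Bstt + \<xi>\<^sub>2 * v Bsstt"
| "lmul S v Bstss = v Btss + \<xi>\<^sub>1 * v Bsstss"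
| "lmul S v Bstts = v Btts + \<xi>\<^sub>1 * v Bsstts"
| "lmul S v Btsst = v Bststst"
| "lmul S v Bttss = v Bssttss"
| "lmul S v Bsstss = v Bstss + \<xi>\<^sub>2 * v Bsstss"
| "lmul S v Bsstts = v Bstts + \<xi>\<^sub>2 * v Bsstts"
| "lmul S v Bttstt = v Btsst + \<xi>\<^sub>1 * v Bststst"
| "lmul S v Bsttss = v Bttss + \<xi>\<^sub>1 * v Bssttss"
| "lmul S v Bststst = v Bttstt + \<xi>\<^sub>2 * v Bststst"
| "lmul S v Bssttss = v Bsttss + \<xi>\<^sub>2 * v Bssttss"
| "lmul T v B1 = v Btt"
| "lmul T v Bs = v Btts"
| "lmul T v Bt = v B1 + \<xi>\<^sub>1 * v Btt + \<xi>\<^sub>1 * v Bsstts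
    + \<xi>\<^sub>1 * \<xi>\<^sub>2 * v Bssttss"
| "lmul T v Bss = v Bttss"
| "lmul T v Bst = v Bstss"
| "lmul T v Bts = v Bs + \<xi>\<^sub>1 * v Btts + \<xi>\<^sub>1^2 * v Bsstts
    + \<xi>\<^sub>1 * v Bssttss + \<xi>\<^sub>1^2 * \<xi>\<^sub>2 * v Bssttss"
| "lmul T v Btt = v Bt + \<xi>\<^sub>2 * v Btt - \<xi>\<^sub>1 * v Bssttss"
| "lmul T v Bsst = \<xi>\<^sub>1 * v Btsst + v Bsttss"
| "lmul T v Bsts = v Bst + \<xi>\<^sub>1 * v Bstss"
| "lmul T v Bstt = v Bttstt - \<xi>\<^sub>1 * v Btsst - \<xi>\<^sub>2 * v Bssttss"
| "lmul T v Btss = v Bss + \<xi>\<^sub>1 * v Bsstt + \<xi>\<^sub>1 * v Bttss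
    + \<xi>\<^sub>1 * \<xi>\<^sub>2 * v Bsstts + \<xi>\<^sub>1 * \<xi>\<^sub>2^2 * v Bssttss
    + \<xi>\<^sub>1^2 * v Bssttss"
| "lmul T v Btts = v Bts + \<xi>\<^sub>2 * v Btts - \<xi>\<^sub>1 * v Bsstt
    - \<xi>\<^sub>1^2 * v Bssttss"
| "lmul T v Bssts = v Bstt + \<xi>\<^sub>1 * v Bttstt + \<xi>\<^sub>1 * v Bsttss"
| "lmul T v Bsstt = v Bssttss"
| "lmul T v Bstss = v Bsts + \<xi>\<^sub>2 * v Bstss"
| "lmul T v Bstts = v Bststst - \<xi>\<^sub>2 * v Bsstt - \<xi>\<^sub>2 * v Btsst
    - \<xi>\<^sub>1 * \<xi>\<^sub>2 * v Bssttss"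
| "lmul T v Btsst = v Bsst + \<xi>\<^sub>2 * v Bsstt + \<xi>\<^sub>2 * v Btsst"
| "lmul T v Bttss = v Btss + \<xi>\<^sub>2 * v Bttss - \<xi>\<^sub>1 * v Bsstts
    - \<xi>\<^sub>1 * \<xi>\<^sub>2 * v Bssttss"
| "lmul T v Bsstss = v Bstts + \<xi>\<^sub>2 * v Bsttss + \<xi>\<^sub>1 * v Bststst"
| "lmul T v Bsstts = v Bsstt + \<xi>\<^sub>1 * v Bssttss"
| "lmul T v Bttstt = v Bssts + \<xi>\<^sub>2 * v Bsstts + \<xi>\<^sub>2 * v Bttstt"
| "lmul T v Bsttss = v Btsst - \<xi>\<^sub>2 * v Bsstts - \<xi>\<^sub>2^2 * v Bssttss"
| "lmul T v Bststst = v Bsstss + \<xi>\<^sub>2 * v Bststst + \<xi>\<^sub>2 * v Bssttss"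
| "lmul T v Bssttss = v Bsstts + \<xi>\<^sub>2 * v Bssttss"

primrec mirror :: "bword \<Rightarrow> bword" where
  "mirror B1 = B1"
| "mirror Bs = Bs"
| "mirror Bt = Bt"
| "mirror Bss = Bss"
| "mirror Bst = Bts"
| "mirror Bts = Bst"
| "mirror Btt = Btt"
| "mirror Bsst = Btss"
| "mirror Bsts = Bsts"
| "mirror Bstt = Btts"
| "mirror Btss = Bsst"
| "mirror Btts = Bstt"
| "mirror Bssts = Bstss"
| "mirror Bsstt = Bttss"
| "mirror Bstss = Bssts"
| "mirror Bstts = Bstts"
| "mirror Btsst = Btsst"
| "mirror Bttss = Bsstt"
| "mirror Bsstss = Bsstss"
| "mirror Bsstts = Bsttss"
| "mirror Bttstt = Bttstt"
| "mirror Bsttss = Bsstts"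
| "mirror Bststst = Bststst"
| "mirror Bssttss = Bssttss"

text \<open>
  Reversal of words is an anti-automorphism of the algebra; it permutes the basis because
  \<open>ststst = tststs\<close> by the braid relation.
\<close>

definition rmul :: "gen \<Rightarrow> vec \<Rightarrow> vec" where
  "rmul x v = (\<lambda>u. lmul x (v \<circ> mirror) (mirror u))"

lemma lmul_zero: "lmul x (\<lambda>_. 0) = (\<lambda>_. 0)"
proof
  fix u show "lmul x (\<lambda>_. 0) u = 0"
    by (cases x; cases u; simp)
qed

lemma lmul_add: "lmul x (\<lambda>u. v u + w u) = (\<lambda>u. lmul x v u + lmul x w u)"
proof
  fix u show "lmul x (\<lambda>u. v u + w u) u = lmul x v u + lmul x w u"
    by (cases x; cases u; simp add: algebra_simps)
qed

lemma lmul_scale: "lmul x (\<lambda>u. c * v u) = (\<lambda>u. c * lmul x v u)"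
proof
  fix u show "lmul x (\<lambda>u. c * v u) u = c * lmul x v u"
    by (cases x; cases u; simp add: algebra_simps)
qed

text \<open>A finite matrix identity, checked row by row. Together with \<open>lmul_cubic\<close> it
  says that the operators \<open>lmul S\<close> and \<open>lmul T\<close> satisfy the defining
  relations.\<close>

lemma lmul_braid: "lmul S (lmul T (lmul S v)) = lmul T (lmul S (lmul T v))"
proof
  fix u show "lmul S (lmul T (lmul S v)) u = lmul T (lmul S (lmul T v)) u"
    by (cases u; simp add: algebra_simps power2_eq_square)
qed

lemma lmul_cubic:
  "lmul x (lmul x (lmul x v))
    = (\<lambda>u. v u + \<xi>\<^sub>1 * lmul x v u + \<xi>\<^sub>2 * lmul x (lmul x v) u)"
proof
  fix u show "lmul x (lmul x (lmul x v)) u = v u + \<xi>\<^sub>1 * lmul x v u + \<xi>\<^sub>2 * lmul x (lmul x v) u"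
    by (cases x; cases u; simp add: algebra_simps power2_eq_square)
qed

lemma rmul_zero: "rmul x (\<lambda>_. 0) = (\<lambda>_. 0)"
  by (simp add: rmul_def comp_def lmul_zero)

lemma rmul_add: "rmul x (\<lambda>u. v u + w u) = (\<lambda>u. rmul x v u + rmul x w u)"
  by (simp add: rmul_def comp_def lmul_add)

lemma rmul_scale: "rmul x (\<lambda>u. c * v u) = (\<lambda>u. c * rmul x v u)"
  by (simp add: rmul_def comp_def lmul_scale)

text \<open>This mirrors the associativity (x h) y = x (h y). At this point \<open>rmul\<close> is
  only a matrix, so the identity is checked entry by entry; it is what later identifies
  \<open>rmul\<close> with right multiplication.\<close>

lemma lmul_rmul_commute: "lmul x (rmul y v) = rmul y (lmul x v)"
proof
  fix u show "lmul x (rmul y v) u = rmul y (lmul x v) u"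
    unfolding rmul_def
    by (cases x; cases y; cases u; simp add: algebra_simps power2_eq_square)
qed

definition delta :: "bword \<Rightarrow> vec" where
  "delta u = (\<lambda>w. if w = u then 1 else 0)"


section \<open>The action of the free algebra on coordinate vectors\<close>

definition word_act :: "gword \<Rightarrow> vec \<Rightarrow> vec" where
  "word_act w v = (case w of Word xs \<Rightarrow> foldr lmul xs v)"

lemma word_act_Word: "word_act (Word xs) v = foldr lmul xs v"
  by (simp add: word_act_def)

lemma word_act_0: "word_act 0 v = v"
  by (simp add: zero_gword_def word_act_Word)

lemma word_act_plus: "word_act (a + b) v = word_act a (word_act b v)"
  by (cases a; cases b) (simp add: word_act_Word)

lemma word_act_zero: "word_act w (\<lambda>_. 0) = (\<lambda>_. 0)"
proof (cases w)
  case (Word xs)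
  then show ?thesis
    by (induction xs arbitrary: w) (simp_all add: word_act_Word lmul_zero)
qed

lemma word_act_add: "word_act a (\<lambda>u. v u + w u) = (\<lambda>u. word_act a v u + word_act a w u)"
proof (cases a)
  case (Word xs)
  then show ?thesis
    by (induction xs arbitrary: a) (simp_all add: word_act_Word lmul_add)
qed

lemma word_act_scale: "word_act a (\<lambda>u. c * v u) = (\<lambda>u. c * word_act a v u)"
proof (cases a)
  case (Word xs)
  then show ?thesis
    by (induction xs arbitrary: a) (simp_all add: word_act_Word lmul_scale)
qed

lemma word_act_rmul: "word_act a (rmul x v) = rmul x (word_act a v)"
proof (cases a)
  case (Word xs)
  then show ?thesis
    by (induction xs arbitrary: a) (simp_all add: word_act_Word lmul_rmul_commute)
qed

definition act :: "free_alg \<Rightarrow> vec \<Rightarrow> vec" where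
  "act f v = (\<lambda>u. \<Sum>w\<in>Poly_Mapping.keys f. Poly_Mapping.lookup f w * word_act w v u)"

text \<open>Cancellation can make the support of a sum smaller than the union of the supports.
  Summing over a common larger index set makes additivity of \<open>act\<close> a termwise
  statement.\<close>

lemma act_superset:
  assumes "finite A" "Poly_Mapping.keys f \<subseteq> A"
  shows "act f v u = (\<Sum>w\<in>A. Poly_Mapping.lookup f w * word_act w v u)"
  unfolding act_def using assms
  by (intro sum.mono_neutral_left) (auto simp: in_keys_iff)

lemma act_0: "act 0 v = (\<lambda>_. 0)"
  by (simp add: act_def)

lemma act_plus: "act (f + g) v = (\<lambda>u. act f v u + act g v u)"
proof
  fix u
  let ?A = "Poly_Mapping.keys f \<union> Poly_Mapping.keys g"
  show "act (f + g) v u = act f v u + act g v u"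
    using act_superset[of ?A "f + g" v u] act_superset[of ?A f v u] act_superset[of ?A g v u]
    by (simp add: keys_add lookup_add distrib_right sum.distrib)
qed

lemma act_single: "act (Poly_Mapping.single a c) v = (\<lambda>u. c * word_act a v u)"
  by (simp add: act_def)

lemma act_uminus: "act (- f) v = (\<lambda>u. - act f v u)"
  by (simp add: act_def sum_negf)

lemma act_minus: "act (f - g) v = (\<lambda>u. act f v u - act g v u)"
  using act_plus[of f "- g" v] by (simp add: act_uminus)

lemma act_free_gen: "act (free_gen x) v = lmul x v"
  by (simp add: free_gen_def act_single word_act_Word)

lemma act_free_const: "act (free_const c) v = (\<lambda>u. c * v u)"
  by (simp add: free_const_def act_single word_act_0)

lemma act_one: "act 1 v = v"
  using act_free_const[of 1] by (simp add: free_const_1)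

lemma free_alg_induct [case_names zero single add]:
  assumes "P 0"
    and "\<And>a c. P (Poly_Mapping.single a c)"
    and "\<And>f g. P f \<Longrightarrow> P g \<Longrightarrow> P (f + g)"
  shows "P (f :: free_alg)"
proof (induction f rule: update_induct)
  case const
  show ?case by (rule assms(1))
next
  case (update f a c)
  have "Poly_Mapping.update a c f = f + Poly_Mapping.single a c"
  proof (rule poly_mapping_eqI)
    fix k
    show "Poly_Mapping.lookup (Poly_Mapping.update a c f) k
        = Poly_Mapping.lookup (f + Poly_Mapping.single a c) k"
      using update(1)
      by (cases "k = a") (simp_all add: lookup_update lookup_add lookup_single in_keys_iff)
  qed
  then show ?case using assms(2,3) update.IH by simp
qed

lemma act_zero: "act f (\<lambda>_. 0) = (\<lambda>_. 0)"
  by (simp add: act_def word_act_zero)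

lemma act_add: "act f (\<lambda>u. v u + w u) = (\<lambda>u. act f v u + act f w u)"
  by (simp add: act_def word_act_add distrib_left sum.distrib)

lemma act_rmul: "act f (rmul x v) = rmul x (act f v)"
  by (induction f rule: free_alg_induct)
    (simp_all add: act_0 act_plus act_single rmul_zero rmul_add rmul_scale word_act_rmul)

text \<open>By additivity in each factor it suffices to take monomials, where concatenation of words
  acts by composition (\<open>word_act_plus\<close>).\<close>

lemma act_mult: "act (f * g) v = act f (act g v)"
proof (induction f rule: free_alg_induct)
  case zero
  show ?case by (simp add: act_0)
next
  case (single a c)
  show ?case
    by (induction g rule: free_alg_induct)
      (simp_all add: act_0 act_zero act_add act_plus act_single distrib_left mult_single
        word_act_plus word_act_scale mult.assoc)
next
  case (add f f')
  then show ?case by (simp add: distrib_right act_plus)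
qed

text \<open>The relators act as zero by \<open>lmul_braid\<close> and \<open>lmul_cubic\<close>. The
  vector stays arbitrary in the induction because a right multiple \<open>f * a\<close> applies the
  hypothesis for \<open>f\<close> to \<open>act a v\<close>.\<close>

lemma act_hecke_ideal: "f \<in> hecke_ideal \<Longrightarrow> act f v = (\<lambda>_. 0)"
proof (induction f arbitrary: v rule: hecke_ideal.induct)
  case (base r)
  then show ?case
  proof cases
    case braid
    then show ?thesis
      by (simp add: act_minus act_mult act_free_gen lmul_braid)
  next
    case (cubic x)
    then show ?thesis
      by (simp add: act_minus act_plus act_one act_mult act_free_gen act_free_const
          power3_eq_cube power2_eq_square lmul_cubic)
  qed
qed (simp_all add: act_0 act_plus act_mult act_zero)

section \<open>Coordinates on the Hecke algebra\<close>

lift_definition coord :: "hecke \<Rightarrow> vec" is "\<lambda>f. act f (delta B1)"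
proof -
  fix f g
  assume "hecke_eq f g"
  then have "act (f - g) (delta B1) = (\<lambda>_. 0)"
    unfolding hecke_eq_def by (rule act_hecke_ideal)
  then show "act f (delta B1) = act g (delta B1)"
    by (simp add: act_minus fun_eq_iff)
qed

lemma coord_zero: "coord 0 = (\<lambda>_. 0)"
  by transfer (rule act_0)

lemma coord_one: "coord 1 = delta B1"
  by transfer (rule act_one)

lemma coord_add: "coord (x + y) = (\<lambda>u. coord x u + coord y u)"
  by transfer (rule act_plus)

lemma coord_diff: "coord (x - y) = (\<lambda>u. coord x u - coord y u)"
  by transfer (rule act_minus)

lemma coord_scale: "coord (c *\<^sub>H x) = (\<lambda>u. c * coord x u)"
  by transfer (simp add: act_mult act_free_const)

lemma coord_gen_mult: "coord (hecke_gen x * h) = lmul x (coord h)"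
  by transfer (simp add: act_mult act_free_gen)

lemma rmul_delta_B1: "rmul x (delta B1) = lmul x (delta B1)"
proof
  fix u show "rmul x (delta B1) u = lmul x (delta B1) u"
    by (cases x; cases u; simp add: rmul_def delta_def)
qed

text \<open>Right multiplication by x replaces the start vector by \<open>lmul x (delta B1)\<close>,
  which is \<open>rmul x (delta B1)\<close>; \<open>rmul x\<close> commutes with the whole left
  action and can be pulled out.\<close>

lemma coord_mult_gen: "coord (h * hecke_gen x) = rmul x (coord h)"
  by transfer (simp add: act_mult act_free_gen act_rmul flip: rmul_delta_B1)

lemma Tw_Nil: "Tw [] = 1"
  by (simp add: Tw_def)

lemma Tw_Cons: "Tw (x # xs) = hecke_gen x * Tw xs"
  by (simp add: Tw_def)

lemma abs_hecke_single: "abs_hecke (Poly_Mapping.single (Word xs) c) = c *\<^sub>H Tw xs"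
proof -
  have "abs_hecke (Poly_Mapping.single (Word xs) 1) = Tw xs"
  proof (induction xs)
    case Nil
    then show ?case by (simp add: Tw_Nil one_hecke_def flip: zero_gword_def)
  next
    case (Cons x xs)
    have "Poly_Mapping.single (Word (x # xs)) 1
        = free_gen x * Poly_Mapping.single (Word xs) (1 :: R)"
      by (simp add: free_gen_def mult_single)
    then show ?case
      by (simp add: Tw_Cons hecke_gen_def times_hecke.abs_eq flip: Cons.IH)
  qed
  moreover have "Poly_Mapping.single (Word xs) c = free_const c * Poly_Mapping.single (Word xs) 1"
    by (simp add: free_const_def mult_single)
  ultimately show ?thesis
    by (simp add: hscale.abs_eq flip: hscale.abs_eq)
qed

text \<open>Every class has a representative that is a finite sum of monomials, so additive claims
  need checking only on scalar multiples of words.\<close>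

lemma hecke_induct [case_names zero Tw add]:
  assumes "P 0"
    and "\<And>c xs. P (c *\<^sub>H Tw xs)"
    and "\<And>x y. P x \<Longrightarrow> P y \<Longrightarrow> P (x + y)"
  shows "P (h :: hecke)"
proof -
  obtain f where f: "h = abs_hecke f"
    using hecke.abs_induct[of "\<lambda>h. \<exists>f. h = abs_hecke f"] by blast
  have "P (abs_hecke f)"
  proof (induction f rule: free_alg_induct)
    case zero
    then show ?case using assms(1) by (simp add: zero_hecke_def)
  next
    case (single a c)
    then show ?case using assms(2) by (cases a) (simp add: abs_hecke_single)
  next
    case (add f g)
    then show ?case using assms(3) by (simp flip: plus_hecke.abs_eq)
  qed
  then show ?thesis using f by simp
qed


section \<open>Rewriting rules derived from the braid and cubic relations\<close>

lemma gen_cubic: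
  "hecke_gen x * (hecke_gen x * hecke_gen x)
    = 1 + \<xi>\<^sub>1 *\<^sub>H hecke_gen x + \<xi>\<^sub>2 *\<^sub>H (hecke_gen x * hecke_gen x)"
  using hecke_cubic[of x] by (simp add: power3_eq_cube power2_eq_square mult.assoc)

lemmas hscale_simps = hscale_mult_left hscale_mult_right hecke.scale_right_distrib
  hecke.scale_right_diff_distrib hecke.scale_left_distrib hecke.scale_left_diff_distrib
  hecke.scale_scale hecke.scale_minus_left hecke.scale_minus_right

text \<open>In right-nested products a rule for \<open>a * (b * c)\<close> does not match when
  further factors follow. This gives the variants with a trailing factor \<open>y\<close>, named
  with the suffix \<open>_mult\<close>.\<close>

lemma assoc_rule: "a * (b * c) = d \<Longrightarrow> a * (b * (c * y)) = d * (y :: hecke)"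
  by (metis mult.assoc)

context
  fixes s t :: hecke
  defines "s \<equiv> hecke_gen S" and "t \<equiv> hecke_gen T"
begin

lemma sss: "s * (s * s) = 1 + \<xi>\<^sub>1 *\<^sub>H s + \<xi>\<^sub>2 *\<^sub>H (s * s)"
  unfolding s_def by (rule gen_cubic)

lemma ttt: "t * (t * t) = 1 + \<xi>\<^sub>1 *\<^sub>H t + \<xi>\<^sub>2 *\<^sub>H (t * t)"
  unfolding t_def by (rule gen_cubic)

lemma tst: "t * (s * t) = s * (t * s)"
  using hecke_braid by (simp add: s_def t_def mult.assoc)

lemma sss_mult: "s * (s * (s * y)) = y + \<xi>\<^sub>1 *\<^sub>H (s * y) + \<xi>\<^sub>2 *\<^sub>H (s * (s * y))"
  using assoc_rule[OF sss, of y] by (simp add: distrib_right hscale_simps mult.assoc)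

lemma ttt_mult: "t * (t * (t * y)) = y + \<xi>\<^sub>1 *\<^sub>H (t * y) + \<xi>\<^sub>2 *\<^sub>H (t * (t * y))"
  using assoc_rule[OF ttt, of y] by (simp add: distrib_right hscale_simps mult.assoc)

lemma tst_mult: "t * (s * (t * y)) = s * (t * (s * y))"
  using assoc_rule[OF tst, of y] by (simp add: mult.assoc)

text \<open>Two braid moves: t s (s t s) = t s (t s t) = (t s t) s t = s t s s t.\<close>

lemma tssts: "t * (s * (s * (t * s))) = s * (t * (s * (s * t)))"
  by (metis tst tst_mult)

lemma tssts_mult: "t * (s * (s * (t * (s * y)))) = s * (t * (s * (s * (t * y))))"
  by (metis tst_mult)

text \<open>The constant term of the cubic relation is 1, so \<open>s\<close> is invertible with
  inverse \<open>s * s - \<xi>\<^sub>2 *\<^sub>H s - \<xi>\<^sub>1 *\<^sub>H 1\<close>. Here x is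
  recovered from s x.\<close>

lemma sss_cancel: "x = s * (s * (s * x)) - \<xi>\<^sub>2 *\<^sub>H (s * (s * x)) - \<xi>\<^sub>1 *\<^sub>H (s * x)"
  by (simp add: sss_mult)

text \<open>Found by Knuth--Bendix completion: both sides agree after multiplication by \<open>s\<close>, which is invertible.\<close>

lemma tsstt:
  "t * (s * (s * (t * t))) = s * (s * (t * (t * s))) + \<xi>\<^sub>2 *\<^sub>H (t * (s * (s * t)))
    - \<xi>\<^sub>2 *\<^sub>H (s * (t * (t * s))) + \<xi>\<^sub>1 *\<^sub>H (t * (s * s)) - \<xi>\<^sub>1 *\<^sub>H (t * (t * s))"
proof -
  \<comment> \<open>Braid moves bring three letters s together, so that the cubic relation
    applies.\<close>
  have "s * (t * (s * (s * (t * t)))) = t * (s * (s * (s * (t * s))))"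
    by (metis tst tst_mult)
  also have "\<dots> = t * (t * s) + \<xi>\<^sub>1 *\<^sub>H (s * (t * (s * s))) + \<xi>\<^sub>2 *\<^sub>H (s * (t * (s * (s * t))))"
    by (simp add: sss_mult tst_mult tssts distrib_left hscale_simps)
  finally have *: "s * (t * (s * (s * (t * t)))) = \<dots>" .
  show ?thesis
    by (subst sss_cancel, unfold *)
      (simp add: sss_mult distrib_left hscale_simps mult.commute algebra_simps)
qed

text \<open>Here the cancelled factor s stands on the right: braid moves turn t t s s t s into s t s
  s s t, where the cubic relation applies.\<close>

lemma ttsst:
  "t * (t * (s * (s * t))) = s * (t * (t * (s * s))) + \<xi>\<^sub>2 *\<^sub>H (t * (s * (s * t)))
    - \<xi>\<^sub>2 *\<^sub>H (s * (t * (t * s))) + \<xi>\<^sub>1 *\<^sub>H (s * (s * t)) - \<xi>\<^sub>1 *\<^sub>H (s * (t * t))"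
proof -
  have cancel: "x = (x * s) * (s * s) - \<xi>\<^sub>2 *\<^sub>H ((x * s) * s) - \<xi>\<^sub>1 *\<^sub>H (x * s)" for x
    by (simp add: sss mult.assoc distrib_left hscale_simps)
  have "(t * (t * (s * (s * t)))) * s = s * (t * (s * (s * (s * t))))"
    by (metis tst tst_mult mult.assoc)
  also have "\<dots> = s * (t * t) + \<xi>\<^sub>1 *\<^sub>H (s * (s * (t * s))) + \<xi>\<^sub>2 *\<^sub>H (s * (t * (s * (s * t))))"
    by (simp add: sss_mult tst distrib_left hscale_simps)
  finally have *: "(t * (t * (s * (s * t)))) * s = \<dots>" .
  show ?thesis
    by (subst cancel, unfold *)
      (simp add: sss sss_mult tssts tssts_mult mult.assoc distrib_left distrib_right hscale_simps
        mult.commute algebra_simps)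
qed

lemma tsstt_mult:
  "t * (s * (s * (t * (t * y)))) = s * (s * (t * (t * (s * y))))
    + \<xi>\<^sub>2 *\<^sub>H (t * (s * (s * (t * y))))
    - \<xi>\<^sub>2 *\<^sub>H (s * (t * (t * (s * y))))
    + \<xi>\<^sub>1 *\<^sub>H (t * (s * (s * y))) - \<xi>\<^sub>1 *\<^sub>H (t * (t * (s * y)))"
  using arg_cong[OF tsstt, of "\<lambda>x. x * y"]
  by (simp add: distrib_right left_diff_distrib hscale_simps mult.assoc)

lemma ttsst_mult:
  "t * (t * (s * (s * (t * y)))) = s * (t * (t * (s * (s * y))))
    + \<xi>\<^sub>2 *\<^sub>H (t * (s * (s * (t * y))))
    - \<xi>\<^sub>2 *\<^sub>H (s * (t * (t * (s * y))))
    + \<xi>\<^sub>1 *\<^sub>H (s * (s * (t * y))) - \<xi>\<^sub>1 *\<^sub>H (s * (t * (t * y)))"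
  using arg_cong[OF ttsst, of "\<lambda>x. x * y"]
  by (simp add: distrib_right left_diff_distrib hscale_simps mult.assoc)

text \<open>The plain rules act at the end of a right-nested product, the \<open>_mult\<close> forms
  inside it.\<close>

lemmas hecke_rewrite = sss ttt tst tssts tsstt ttsst sss_mult ttt_mult tst_mult tssts_mult
  tsstt_mult ttsst_mult

end

section \<open>Recovering an element from its coordinates\<close>

definition from_coord :: "vec \<Rightarrow> hecke" where
  "from_coord v = (\<Sum>u\<in>UNIV. v u *\<^sub>H Tw (word u))"

text \<open>Both sides are rewritten to normal form and coefficients compared. Two basis words are
  themselves reducible: ttstt becomes stsst and ststst becomes sstsst.\<close>

lemma from_coord_lmul: "hecke_gen x * from_coord v = from_coord (lmul x v)"
proof -
  have "hecke_gen S * from_coord v = from_coord (lmul S v)"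
    by (simp add: from_coord_def UNIV_bword Tw_Cons Tw_Nil distrib_left distrib_right hscale_simps
        hecke_rewrite power2_eq_square algebra_simps)
  moreover have "hecke_gen T * from_coord v = from_coord (lmul T v)"
    by (simp add: from_coord_def UNIV_bword Tw_Cons Tw_Nil distrib_left distrib_right hscale_simps
        hecke_rewrite power2_eq_square algebra_simps)
  ultimately show ?thesis
    by (cases x) simp_all
qed

lemma from_coord_zero: "from_coord (\<lambda>_. 0) = 0"
  by (simp add: from_coord_def)

lemma from_coord_add: "from_coord (\<lambda>u. v u + w u) = from_coord v + from_coord w"
  by (simp add: from_coord_def hecke.scale_left_distrib sum.distrib)

lemma from_coord_scale: "from_coord (\<lambda>u. c * v u) = c *\<^sub>H from_coord v"
  by (simp add: from_coord_def hecke.scale_sum_right)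

lemma from_coord_delta: "from_coord (delta u) = Tw (word u)"
proof -
  have "delta u w *\<^sub>H Tw (word w) = (if w = u then Tw (word w) else 0)" for w
    by (simp add: delta_def)
  then show ?thesis
    by (simp add: from_coord_def)
qed

text \<open>Both maps turn left multiplication by a generator into \<open>lmul\<close> or back, so
  on words the claim follows letter by letter from the case of 1. Hence the 24 words span and
  \<open>coord\<close> is injective.\<close>

lemma from_coord_coord: "from_coord (coord h) = h"
proof (induction h rule: hecke_induct)
  case zero
  then show ?case by (simp add: coord_zero from_coord_zero)
next
  case (Tw c xs)
  have "from_coord (coord (Tw xs)) = Tw xs"
    by (induction xs)
      (simp_all add: Tw_Nil Tw_Cons coord_one from_coord_delta coord_gen_mult flip: from_coord_lmul)
  then show ?case by (simp add: coord_scale from_coord_scale)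
next
  case (add x y)
  then show ?case by (simp add: coord_add from_coord_add)
qed

lemma coord_inject: "coord x = coord y \<longleftrightarrow> x = y"
  by (metis from_coord_coord)

section \<open>Coordinates and centrality of b1, ..., b7\<close>

text \<open>These products suffice to build every word in b1, ..., b7 from its last letter. Each
  intermediate product is a single basis element; for instance ttstt passes through t, tt, stt and
  tstt = ssts.\<close>

lemma lmul_delta:
  "lmul S (delta B1) = delta Bs"
  "lmul T (delta B1) = delta Bt"
  "lmul S (delta Bs) = delta Bss"
  "lmul S (delta Bt) = delta Bst"
  "lmul T (delta Bs) = delta Bts"
  "lmul T (delta Bt) = delta Btt"
  "lmul S (delta Bst) = delta Bsst"
  "lmul S (delta Bts) = delta Bsts"
  "lmul S (delta Btt) = delta Bstt"
  "lmul T (delta Bss) = delta Btss"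
  "lmul T (delta Bts) = delta Btts"
  "lmul S (delta Bsts) = delta Bssts"
  "lmul S (delta Bstt) = delta Bsstt"
  "lmul S (delta Btss) = delta Bstss"
  "lmul S (delta Btts) = delta Bstts"
  "lmul T (delta Bsst) = delta Btsst"
  "lmul T (delta Btss) = delta Bttss"
  "lmul S (delta Bstss) = delta Bsstss"
  "lmul S (delta Bstts) = delta Bsstts"
  "lmul S (delta Bttss) = delta Bsttss"
  "lmul S (delta Bsttss) = delta Bssttss"
  "lmul T (delta Bst) = delta Bsts"
  "lmul T (delta Bstt) = delta Bssts"
  "lmul T (delta Bssts) = delta Bttstt"
  "lmul S (delta Bttstt) = delta Bststst"
  by (rule ext; rename_tac u; case_tac u; simp add: delta_def)+

lemma coord_Tw: "coord (Tw xs) = foldr lmul xs (delta B1)"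
  by (induction xs) (simp_all add: Tw_Nil Tw_Cons coord_one coord_gen_mult)

text \<open>Commuting with both generators suffices, since it extends to words by induction and then
  linearly. Injectivity of \<open>coord\<close> turns it into equations between vectors.\<close>

lemma in_centre_iff: "z \<in> centre \<longleftrightarrow> (\<forall>x. lmul x (coord z) = rmul x (coord z))"
proof
  assume "z \<in> centre"
  then show "\<forall>x. lmul x (coord z) = rmul x (coord z)"
    by (simp add: centre_def flip: coord_gen_mult coord_mult_gen)
next
  assume *: "\<forall>x. lmul x (coord z) = rmul x (coord z)"
  have gen: "z * hecke_gen x = hecke_gen x * z" for x
    using * by (simp add: coord_gen_mult coord_mult_gen flip: coord_inject)
  have "z * h = h * z" for h
  proof (induction h rule: hecke_induct)
    case (Tw c xs)
    have "z * Tw xs = Tw xs * z"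
    proof (induction xs)
      case (Cons x xs)
      have "z * Tw (x # xs) = (z * hecke_gen x) * Tw xs"
        by (simp add: Tw_Cons mult.assoc)
      also have "\<dots> = hecke_gen x * (z * Tw xs)"
        by (simp add: gen mult.assoc)
      finally show ?case
        by (simp add: Cons.IH Tw_Cons mult.assoc)
    qed (simp add: Tw_Nil)
    then show ?case by (simp add: hscale_simps)
  qed (simp_all add: distrib_left distrib_right)
  then show "z \<in> centre"
    by (simp add: centre_def)
qed

lemmas coord_b [unfolded coord_add coord_diff coord_scale coord_Tw foldr.simps comp_apply id_apply
    lmul_delta] =
  b1_def [THEN arg_cong [where f = coord]]
  b2_def [THEN arg_cong [where f = coord]]
  b3_def [THEN arg_cong [where f = coord]]
  b4_def [THEN arg_cong [where f = coord]]
  b5_def [THEN arg_cong [where f = coord]]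
  b6_def [THEN arg_cong [where f = coord]]
  b7_def [THEN arg_cong [where f = coord]]

lemma in_centreI:
  assumes "\<And>x u. lmul x (coord z) u = rmul x (coord z) u"
  shows "z \<in> centre"
  using assms by (auto simp: in_centre_iff fun_eq_iff)

text \<open>For each element, two generators and 24 coordinates give 48 polynomial identities in the
  two indeterminates.\<close>

lemma b_in_centre:
  "b1 \<in> centre" "b2 \<in> centre" "b3 \<in> centre" "b4 \<in> centre" "b5 \<in> centre" "b6 \<in> centre" "b7 \<in> centre"
  by (rule in_centreI, rename_tac x u, case_tac x; case_tac u;
      simp add: rmul_def coord_b delta_def algebra_simps power2_eq_square)+

lemma subspace_centre: "hecke.subspace centre"
  by (simp add: hecke.subspace_def centre_def distrib_left distrib_right hscale_simps)

section \<open>Seven coordinates that determine a central element\<close>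

definition pivots :: "hecke \<Rightarrow> R list" where
  "pivots h = map (coord h) [B1, Bststst, Bs, Bst, Bss, Bstt, Bsstt]"

lemma pivots_b:
  "pivots b1 = [1, 0, 0, 0, 0, 0, 0]"
  "pivots b2 = [0, 1, 0, 0, 0, 0, 0]"
  "pivots b3 = [0, 0, 1, 0, 0, 0, 0]"
  "pivots b4 = [0, 0, 0, 1, 0, 0, 0]"
  "pivots b5 = [0, 0, 0, 0, 1, 0, 0]"
  "pivots b6 = [0, 0, 0, 0, 0, 1, 0]"
  "pivots b7 = [0, 0, 0, 0, 0, 0, 1]"
  by (simp_all add: pivots_def coord_b delta_def)

lemma pivots_combination:
  "pivots (c1 *\<^sub>H b1 + c2 *\<^sub>H b2 + c3 *\<^sub>H b3 + c4 *\<^sub>H b4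
      + c5 *\<^sub>H b5 + c6 *\<^sub>H b6 + c7 *\<^sub>H b7)
    = [c1, c2, c3, c4, c5, c6, c7]"
  using pivots_b by (simp add: pivots_def coord_add coord_scale)

text \<open>The commutation equations are solved one unknown at a time, each with a unit
  coefficient, so no division in R occurs.\<close>

lemma central_zero:
  assumes "z \<in> centre" and "pivots z = [0, 0, 0, 0, 0, 0, 0]"
  shows "z = 0"
proof -
  define v where "v = coord z"
  have eq: "lmul x v u = rmul x v u" for x u
    using assms(1) by (simp add: in_centre_iff v_def)
  have piv: "v B1 = 0" "v Bststst = 0" "v Bs = 0" "v Bst = 0" "v Bss = 0" "v Bstt = 0" "v Bsstt = 0"
    using assms(2) by (simp_all add: pivots_def v_def)
  have ttss: "v Bttss = 0"
    using eq[of S Btt] by (simp add: rmul_def algebra_simps power2_eq_square piv)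
  have ssttss: "v Bssttss = 0"
    using eq[of S Bsstt] by (simp add: rmul_def algebra_simps power2_eq_square piv)
  have tts: "v Btts = 0"
    using eq[of S Bttss] by (simp add: rmul_def algebra_simps power2_eq_square ttss ssttss)
  \<comment> \<open>From here on \<open>v Bsttss\<close> serves as a parameter: the remaining
    coordinates come out as multiples of it.\<close>
  have sstts: "v Bsstts = v Bsttss"
    using eq[of S Bssttss] by (simp add: rmul_def algebra_simps power2_eq_square)
  have tt: "v Btt = v Bsttss"
    using eq[of S Bstt] by (simp add: rmul_def algebra_simps power2_eq_square piv)
  have stts: "v Bstts = - \<xi>\<^sub>2 * v Bsttss"
    using eq[of S Bsstts] by (simp add: rmul_def algebra_simps power2_eq_square piv sstts ssttss)
  have sst: "v Bsst = \<xi>\<^sub>1 * v Bsttss"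
    using eq[of T Bsstt] by (simp add: rmul_def algebra_simps power2_eq_square piv ssttss)
  have tss: "v Btss = \<xi>\<^sub>1 * v Bsttss"
    using eq[of S Bt] by (simp add: rmul_def algebra_simps power2_eq_square sst)
  have sstss: "v Bsstss = \<xi>\<^sub>1 * \<xi>\<^sub>2 * v Bsttss"
    using eq[of S Bsst] by (simp add: rmul_def algebra_simps power2_eq_square piv sst)
  have ts: "v Bts = 0"
    using eq[of S Btss] by (simp add: rmul_def algebra_simps power2_eq_square tss sstss)
  have stss: "v Bstss = \<xi>\<^sub>1 * \<xi>\<^sub>1 * v Bsttss"
    using eq[of T Bst] by (simp add: rmul_def algebra_simps power2_eq_square piv ssttss)
  have ssts: "v Bssts = \<xi>\<^sub>1 * \<xi>\<^sub>1 * v Bsttss"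
    using eq[of S Bsstss] by (simp add: rmul_def algebra_simps power2_eq_square stss)
  have t: "v Bt = 0"
    using eq[of S Bst] by (simp add: rmul_def algebra_simps power2_eq_square sst stss)
  have sts: "v Bsts = \<xi>\<^sub>1 * v Bsttss"
    using eq[of S Bssts] by (simp add: rmul_def algebra_simps power2_eq_square sst ssts sstss)
  have tsst: "v Btsst = \<xi>\<^sub>2 * v Bsttss"
    using eq[of T Bsstts] by (simp add: rmul_def algebra_simps power2_eq_square piv ssttss)
  have ttstt: "v Bttstt = \<xi>\<^sub>1 * \<xi>\<^sub>2 * v Bsttss"
    using eq[of T Bstt] by (simp add: rmul_def algebra_simps power2_eq_square piv tsst ttss ssttss)
  \<comment> \<open>Both sides contain \<open>\<xi>\<^sub>1 * \<xi>\<^sub>2 * v Bsttss\<close>; it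
    cancels and leaves the parameter alone with coefficient 1.\<close>
  have sttss: "v Bsttss = 0"
    using eq[of T Bsst] by (simp add: rmul_def algebra_simps power2_eq_square piv tsst ttss ssttss)
  have "v u = 0" for u
    by (cases u)
      (simp_all add: sttss piv ttss ssttss tts sstts tt stts sst tss sstss ts stss ssts t sts tsst
        ttstt)
  then have "coord z = coord 0"
    by (simp add: v_def coord_zero fun_eq_iff)
  then show ?thesis
    by (simp add: coord_inject)
qed

theorem corollary3p9:
  shows "distinct [b1, b2, b3, b4, b5, b6, b7]
    \<and> hecke.independent {b1, b2, b3, b4, b5, b6, b7}
    \<and> hecke.span {b1, b2, b3, b4, b5, b6, b7} = centre"
proof (intro conjI)
  \<comment> \<open>Distinct pivot lists force distinct elements; this is what lets the sum over the
    set below split into seven terms.\<close>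
  have "distinct (map pivots [b1, b2, b3, b4, b5, b6, b7])"
    by (simp add: pivots_b)
  then show dist: "distinct [b1, b2, b3, b4, b5, b6, b7]"
    by (simp only: distinct_map)
  have sum: "(\<Sum>b\<in>{b1, b2, b3, b4, b5, b6, b7}. c b *\<^sub>H b) = c b1 *\<^sub>H b1 + c b2 *\<^sub>H b2 + c b3 *\<^sub>H b3 + c b4 *\<^sub>H b4
      + c b5 *\<^sub>H b5 + c b6 *\<^sub>H b6 + c b7 *\<^sub>H b7" for c
    using dist by (simp add: add.assoc)
  show "hecke.independent {b1, b2, b3, b4, b5, b6, b7}"
  proof -
    have "c b = 0" if "(\<Sum>b\<in>{b1, b2, b3, b4, b5, b6, b7}. c b *\<^sub>H b) = 0"
      and "b \<in> {b1, b2, b3, b4, b5, b6, b7}" for c b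
    proof -
      \<comment> \<open>The pivots of a combination are its coefficients, so a vanishing combination
        has only zero coefficients.\<close>
      have "[c b1, c b2, c b3, c b4, c b5, c b6, c b7] = pivots 0"
        using that(1) unfolding sum by (simp only: flip: pivots_combination)
      then show ?thesis using that(2) by (auto simp: pivots_def coord_zero)
    qed
    then show ?thesis by (subst hecke.dependent_finite) auto
  qed
  show "hecke.span {b1, b2, b3, b4, b5, b6, b7} = centre" (is "hecke.span ?B = _")
  proof
    show "hecke.span ?B \<subseteq> centre"
      by (rule hecke.span_minimal) (simp_all add: b_in_centre subspace_centre)
    show "centre \<subseteq> hecke.span ?B"
    proof
      fix z :: hecke assume z: "z \<in> centre"
      let ?c = "coord z"
      \<comment> \<open>The pivots of z are the only possible coefficients. With them z - w is
        central with zero pivots, hence 0.\<close>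
      define w where "w = ?c B1 *\<^sub>H b1 + ?c Bststst *\<^sub>H b2 + ?c Bs *\<^sub>H b3 + ?c Bst *\<^sub>H b4
      + ?c Bss *\<^sub>H b5 + ?c Bstt *\<^sub>H b6 + ?c Bsstt *\<^sub>H b7"
      have w: "w \<in> hecke.span ?B"
        unfolding w_def by (intro hecke.span_add hecke.span_scale hecke.span_base) auto
      then have "w \<in> centre"
        using hecke.span_minimal[of ?B centre] by (auto simp: b_in_centre subspace_centre)
      then have "z - w \<in> centre"
        using z by (simp add: centre_def algebra_simps)
      moreover have "pivots w = pivots z"
        unfolding w_def pivots_combination by (simp add: pivots_def)
      then have "pivots (z - w) = [0, 0, 0, 0, 0, 0, 0]"
        by (simp add: pivots_def coord_diff)
      ultimately have "z = w"
        using central_zero[of "z - w"] by simp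
      then show "z \<in> hecke.span ?B" using w by simp
    qed
  qed
qed

end
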